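(* Let $D$ be an integral domain that is a valuation factorization domain (VFD). Then $D$ is a Schreier domain.
   Context: Let $D$ be an integral domain with quotient field $K$. An overring of $D$ is a subring of $K$ containing $D$; a valuation overring is an overring that is a valuation domain. A nonzero nonunit $a\in D$ is a valuation element of $D$ if there is a valuation overring $V$ of $D$ with $aV\cap D=aD$. $D$ is a valuation factorization domain (VFD) if every nonzero nonunit of $D$ is a finite product of valuation elements of $D$. Write $a\mid_D b$ if $b=ac$ for some $c\in D$. $D$ is a pre-Schreier domain if for all nonzero $x,y,z\in D$ with $x\mid_D yz$ there are $a,b\in D$ with $x=ab$, $a\mid_D y$ and $b\mid_D z$. A Schreier domain is an integrally closed pre-Schreier domain. *)

theory Defs
  imports "HOL-Computational_Algebra.Polynomial_Factorial"
begin

text \<open>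
  The integral domain \<open>D\<close> is the type \<open>'a :: idom\<close>; properties of \<open>D\<close> as a whole take an argument
  of type \<open>'a itself\<close>. The quotient field \<open>K\<close> is \<open>'a fract\<close>, with \<open>D\<close> embedded in it as
  \<open>range to_fract\<close>. Subrings are unital.
\<close>

definition overring :: "'a::idom fract set \<Rightarrow> bool" where
  "overring V \<longleftrightarrow>
     range to_fract \<subseteq> V \<and> (\<forall>x\<in>V. \<forall>y\<in>V. x - y \<in> V) \<and> (\<forall>x\<in>V. \<forall>y\<in>V. x * y \<in> V)"

text \<open>
  An overring is a subring of a field, hence a domain; it is a valuation domain if any two of its
  elements are comparable with respect to divisibility in \<open>V\<close> (not in \<open>K\<close>).
\<close>

definition valuation_overring :: "'a::idom fract set \<Rightarrow> bool" where
  "valuation_overring V \<longleftrightarrow> overring V \<and>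
     (\<forall>x\<in>V. \<forall>y\<in>V. (\<exists>c\<in>V. y = x * c) \<or> (\<exists>c\<in>V. x = y * c))"

definition valuation_element :: "'a::idom \<Rightarrow> bool" where
  "valuation_element a \<longleftrightarrow> a \<noteq> 0 \<and> \<not> a dvd 1 \<and>
     (\<exists>V. valuation_overring V \<and>
       (\<lambda>v. to_fract a * v) ` V \<inter> range to_fract = to_fract ` range (\<lambda>d. a * d))"

definition VFD :: "'a::idom itself \<Rightarrow> bool" where
  "VFD D \<longleftrightarrow> (\<forall>x::'a. x \<noteq> 0 \<and> \<not> x dvd 1 \<longrightarrow>
     (\<exists>as. (\<forall>a\<in>set as. valuation_element a) \<and> x = prod_list as))"

definition pre_Schreier_domain :: "'a::idom itself \<Rightarrow> bool" where
  "pre_Schreier_domain D \<longleftrightarrow> (\<forall>x y z :: 'a. x \<noteq> 0 \<and> y \<noteq> 0 \<and> z \<noteq> 0 \<and> x dvd y * z \<longrightarrow>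
     (\<exists>a b. x = a * b \<and> a dvd y \<and> b dvd z))"

text \<open>
  \<open>fract_poly p\<close> is the polynomial \<open>p\<close> over \<open>D\<close>, regarded as a polynomial over \<open>K\<close>.
\<close>

definition integrally_closed_domain :: "'a::idom itself \<Rightarrow> bool" where
  "integrally_closed_domain D \<longleftrightarrow>
     (\<forall>x :: 'a fract. (\<exists>p :: 'a poly. lead_coeff p = 1 \<and> poly (fract_poly p) x = 0) \<longrightarrow>
       x \<in> range to_fract)"

definition Schreier_domain :: "'a::idom itself \<Rightarrow> bool" where
  "Schreier_domain D \<longleftrightarrow> integrally_closed_domain D \<and> pre_Schreier_domain D"

end

theory Submission
  imports Defs
begin

text \<open>
  For a valuation overring \<open>V\<close>, an element \<open>x\<close> of \<open>D\<close> with \<open>x V \<inter> D = x D\<close> has the property that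
  divisibility by \<open>x\<close> in \<open>D\<close> can be tested in \<open>V\<close>. The proof rests on the fact that this property,
  for a fixed \<open>V\<close>, passes from \<open>x\<close> to its divisors and to its powers.

  The domain is integrally closed because \<open>D\<close> is the intersection of valuation overrings: if
  \<open>f \<in> K\<close> lies in every valuation overring and \<open>f z\<^sub>1 \<cdots> z\<^sub>k \<in> D\<close> with valuation
  elements \<open>z\<^sub>i\<close>, then testing divisibility by \<open>z\<^sub>i\<close> in its own overring cancels the factors
  \<open>z\<^sub>i\<close> one after the other (\<open>cancel_denominator\<close>). Every denominator divides such a product
  \<open>z\<^sub>1 \<cdots> z\<^sub>k\<close>, so \<open>f \<in> D\<close>. An element integral over \<open>D\<close> lies in every valuation overring.

  For the pre-Schreier property, let a valuation element \<open>x\<close> divide a product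
  \<open>z\<^sub>1 \<cdots> z\<^sub>k\<close> of valuation elements. In the overring \<open>V\<close> of \<open>x\<close> the factors are linearly
  ordered by divisibility, so \<open>x\<close> divides a power of the last one, first in \<open>V\<close> and then in \<open>D\<close>
  (\<open>dvd_power_of_factor\<close>). Say \<open>x\<close> divides \<open>z\<^sub>i\<^sup>n\<close>. The overring \<open>W\<close> of
  \<open>z\<^sub>i\<close> then also tests divisibility by \<open>z\<^sub>i\<^sup>n\<close> and by its divisor \<open>x\<close>, and since
  \<open>x\<close> and \<open>z\<^sub>i\<close> are comparable in \<open>W\<close>, they are comparable in \<open>D\<close>
  (\<open>comparable_of_dvd_power\<close>). So \<open>x\<close> either divides a factor, or one factor
  can be cancelled from \<open>x\<close> and from the product; induction on \<open>k\<close> splits \<open>x\<close>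
  (\<open>valuative_splits\<close>). Finally, elements that split in this way are closed under products.
\<close>

section \<open>Divisibility tested in a valuation overring\<close>

definition dvd_in :: "'a::idom fract set \<Rightarrow> 'a \<Rightarrow> 'a \<Rightarrow> bool" where
  "dvd_in V x y \<longleftrightarrow> (\<exists>v\<in>V. to_fract y = to_fract x * v)"

text \<open>
  For \<open>x \<noteq> 0\<close> the last clause is \<open>x V \<inter> D = x D\<close>. Unlike for valuation elements, units are admitted,
  so that the property is inherited by all divisors.
\<close>

definition tests_dvd :: "'a::idom fract set \<Rightarrow> 'a \<Rightarrow> bool" where
  "tests_dvd V x \<longleftrightarrow> valuation_overring V \<and> x \<noteq> 0 \<and> (\<forall>d. dvd_in V x d \<longrightarrow> x dvd d)"

lemma overring_closed:
  assumes "overring V"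
  shows "to_fract a \<in> V" and "x \<in> V \<Longrightarrow> y \<in> V \<Longrightarrow> x - y \<in> V"
    and "x \<in> V \<Longrightarrow> y \<in> V \<Longrightarrow> x * y \<in> V"
  using assms unfolding overring_def by auto

lemma overring_one: "overring V \<Longrightarrow> 1 \<in> V"
  using overring_closed(1)[of V 1] by simp

lemma overring_zero: "overring V \<Longrightarrow> 0 \<in> V"
  using overring_closed(1)[of V 0] by simp

lemma overring_uminus:
  assumes "overring V" "x \<in> V" shows "- x \<in> V"
  using overring_closed(2)[OF assms(1) overring_zero[OF assms(1)] assms(2)] by simp

lemma overring_add:
  assumes "overring V" "x \<in> V" "y \<in> V" shows "x + y \<in> V"
  using overring_closed(2)[OF assms(1,2) overring_uminus[OF assms(1,3)]] by simp

lemma overring_sum: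
  assumes "overring V" "\<And>i. i \<in> I \<Longrightarrow> f i \<in> V" shows "sum f I \<in> V"
  using assms(2)
  by (induction I rule: infinite_finite_induct)
    (auto intro: overring_zero overring_add assms(1))

lemma overring_power:
  assumes "overring V" "x \<in> V" shows "x ^ n \<in> V"
  by (induction n) (auto intro: overring_one overring_closed(3) assms)

lemma valuation_overring_overring: "valuation_overring V \<Longrightarrow> overring V"
  unfolding valuation_overring_def by blast

lemma dvd_in_of_dvd: "overring V \<Longrightarrow> x dvd y \<Longrightarrow> dvd_in V x y"
  unfolding dvd_in_def by (auto elim!: dvdE intro: overring_closed(1))

lemma dvd_in_trans:
  assumes "overring V" "dvd_in V x y" "dvd_in V y z" shows "dvd_in V x z"
  using assms(2,3) unfolding dvd_in_def
  by (metis assms(1) mult.assoc overring_closed(3))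

lemma dvd_in_mult_left:
  assumes "dvd_in V x y" shows "dvd_in V (c * x) (c * y)"
  using assms unfolding dvd_in_def by (auto simp: mult.assoc)

lemma dvd_in_mult_left_cancel:
  assumes "dvd_in V (c * x) (c * y)" "c \<noteq> 0" shows "dvd_in V x y"
  using assms unfolding dvd_in_def by (auto simp: mult.assoc)

lemma dvd_in_linear:
  assumes "valuation_overring V" shows "dvd_in V x y \<or> dvd_in V y x"
proof -
  have "to_fract x \<in> V" "to_fract y \<in> V"
    using overring_closed(1)[OF valuation_overring_overring[OF assms]] by auto
  then show ?thesis using assms unfolding valuation_overring_def dvd_in_def by simp
qed

lemma valuation_element_tests_dvd:
  assumes "valuation_element x" obtains V where "tests_dvd V x"
proof -
  from assms obtain V where V: "valuation_overring V" "x \<noteq> 0"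
    and eq: "(\<lambda>v. to_fract x * v) ` V \<inter> range to_fract = to_fract ` range (\<lambda>d. x * d)"
    unfolding valuation_element_def by blast
  have "x dvd d" if "dvd_in V x d" for d
  proof -
    have "to_fract d \<in> (\<lambda>v. to_fract x * v) ` V \<inter> range to_fract"
      using that unfolding dvd_in_def by blast
    then have "to_fract d \<in> to_fract ` range (\<lambda>d. x * d)" using eq by simp
    then show ?thesis by (auto simp del: to_fract_mult)
  qed
  then show ?thesis using that V unfolding tests_dvd_def by blast
qed

lemma tests_dvd_divisor:
  assumes "tests_dvd V x" "y dvd x" shows "tests_dvd V y"
proof -
  obtain c where c: "x = c * y" using assms(2) by (metis dvdE mult.commute)
  have nz: "c \<noteq> 0" "y \<noteq> 0" using assms(1) c unfolding tests_dvd_def by auto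
  have "y dvd d" if "dvd_in V y d" for d
  proof -
    have "x dvd c * d"
      using assms(1) dvd_in_mult_left[OF that, of c] c unfolding tests_dvd_def by blast
    then show ?thesis using c nz by simp
  qed
  then show ?thesis using assms(1) nz unfolding tests_dvd_def by blast
qed

lemma tests_dvd_mult:
  assumes "tests_dvd V x" "tests_dvd V y" shows "tests_dvd V (x * y)"
proof -
  have V: "valuation_overring V" and nz: "x \<noteq> 0" "y \<noteq> 0"
    using assms unfolding tests_dvd_def by auto
  have "x * y dvd d" if d: "dvd_in V (x * y) d" for d
  proof -
    have "dvd_in V x (x * y)"
      using dvd_in_of_dvd[OF valuation_overring_overring[OF V]] by simp
    then have "x dvd d"
      using dvd_in_trans[OF valuation_overring_overring[OF V] _ d] assms(1)
      unfolding tests_dvd_def by blast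
    then obtain e where e: "d = x * e" by (rule dvdE)
    have "y dvd e"
      using dvd_in_mult_left_cancel[of V x y e] d e nz assms(2) unfolding tests_dvd_def by blast
    then show ?thesis using e by simp
  qed
  then show ?thesis using V nz unfolding tests_dvd_def by simp
qed

lemma tests_dvd_power:
  assumes "tests_dvd V x" shows "tests_dvd V (x ^ n)"
proof (induction n)
  case 0
  show ?case using tests_dvd_divisor[OF assms, of 1] by simp
next
  case (Suc n)
  then show ?case using tests_dvd_mult[OF assms] by simp
qed

lemma tests_dvd_linear:
  assumes "tests_dvd V x" "tests_dvd V y" shows "x dvd y \<or> y dvd x"
  using assms dvd_in_linear[of V x y] unfolding tests_dvd_def by auto

section \<open>Integral closedness\<close>

lemma fract_as_quotient:
  obtains a b where "f = to_fract a / to_fract b" "b \<noteq> 0"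
  by (cases f) (metis Fract_conv_to_fract)

text \<open>
  The definition of a valuation overring compares only elements of \<open>V\<close>; this extends to
  fractions because numerator and denominator lie in \<open>D \<subseteq> V\<close>.
\<close>

lemma valuation_overring_inverse:
  assumes "valuation_overring V" "f \<notin> V" shows "inverse f \<in> V"
proof -
  obtain a b where f: "f = to_fract a / to_fract b" and b: "b \<noteq> 0"
    by (rule fract_as_quotient)
  consider (le) v where "v \<in> V" "to_fract b = to_fract a * v"
    | (ge) v where "v \<in> V" "to_fract a = to_fract b * v"
    using dvd_in_linear[OF assms(1), of a b] unfolding dvd_in_def by blast
  then show ?thesis
  proof cases
    case le
    then have "a \<noteq> 0" using b by auto
    then show ?thesis using le f b by (simp add: field_simps)
  next
    case ge
    then have "f = v" using f b by simp
    then show ?thesis using assms(2) ge by simp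
  qed
qed

text \<open>
  If \<open>f \<notin> V\<close>, then \<open>1/f \<in> V\<close>, and an integral equation of degree \<open>n\<close> multiplied by
  \<open>(1/f)\<^sup>n\<^sup>-\<^sup>1\<close> expresses \<open>f\<close> by elements of \<open>V\<close>.
\<close>

lemma integral_in_valuation_overring:
  fixes p :: "'a::idom poly"
  assumes V: "valuation_overring V" and monic: "lead_coeff p = 1"
    and root: "poly (fract_poly p) f = 0"
  shows "f \<in> V"
proof (rule ccontr)
  assume f: "f \<notin> V"
  have O: "overring V" by (rule valuation_overring_overring[OF V])
  define g where "g = inverse f"
  have g: "g \<in> V" unfolding g_def by (rule valuation_overring_inverse[OF V f])
  have f0: "f \<noteq> 0" using f overring_zero[OF O] by auto
  have expand: "poly (fract_poly p) f = (\<Sum>i\<le>degree p. to_fract (coeff p i) * f ^ i)"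
    by (simp add: poly_altdef coeff_map_poly degree_map_poly)
  show False
  proof (cases "degree p")
    case 0
    then show ?thesis using expand root monic by simp
  next
    case (Suc n)
    have "f ^ Suc n = - (\<Sum>i\<le>n. to_fract (coeff p i) * f ^ i)"
      using expand root monic Suc by (simp add: eq_neg_iff_add_eq_0 add.commute)
    then have "f ^ Suc n * g ^ n = - (\<Sum>i\<le>n. to_fract (coeff p i) * (f ^ i * g ^ n))"
      by (simp add: sum_distrib_right mult.assoc)
    also have "(\<Sum>i\<le>n. to_fract (coeff p i) * (f ^ i * g ^ n))
        = (\<Sum>i\<le>n. to_fract (coeff p i) * g ^ (n - i))"
      unfolding g_def using f0
      by (intro sum.cong) (auto simp: power_inverse field_simps simp flip: power_add)
    also have "f ^ Suc n * g ^ n = f"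
      unfolding g_def using f0 by (simp add: power_inverse)
    finally have eq: "f = - (\<Sum>i\<le>n. to_fract (coeff p i) * g ^ (n - i))" .
    have "- (\<Sum>i\<le>n. to_fract (coeff p i) * g ^ (n - i)) \<in> V"
      by (intro overring_uminus[OF O] overring_sum[OF O] overring_closed(3)[OF O]
          overring_closed(1)[OF O] overring_power[OF O g])
    then have "f \<in> V" unfolding eq[symmetric] .
    then show False using f by simp
  qed
qed

text \<open>
  A factor \<open>z\<close> can be cancelled because \<open>f * to_fract (prod_mset A)\<close> lies in the overring
  of \<open>z\<close>, so \<open>z\<close> divides \<open>z * f * to_fract (prod_mset A)\<close> there and hence in \<open>D\<close>.
\<close>

lemma cancel_denominator:
  fixes f :: "'a::idom fract"
  assumes f: "\<And>V. valuation_overring V \<Longrightarrow> f \<in> V"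
    and "\<forall>z\<in>#A. valuation_element z" "f * to_fract (prod_mset A) \<in> range to_fract"
  shows "f \<in> range to_fract"
  using assms(2,3)
proof (induction A)
  case empty
  then show ?case by simp
next
  case (add z A)
  obtain V where V: "tests_dvd V z"
    using add.prems(1) valuation_element_tests_dvd[of z] by auto
  then have VO: "valuation_overring V" and z: "z \<noteq> 0" unfolding tests_dvd_def by auto
  define h where "h = f * to_fract (prod_mset A)"
  have "h \<in> V"
    unfolding h_def using f[OF VO] overring_closed[OF valuation_overring_overring[OF VO]] by blast
  moreover obtain d where d: "to_fract d = to_fract z * h"
    using add.prems(2) unfolding h_def by (auto simp: mult_ac)
  ultimately have "z dvd d" using V unfolding tests_dvd_def dvd_in_def by blast
  then obtain e where "d = z * e" by (rule dvdE)
  then have "h = to_fract e" using d z by simp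
  then have "h \<in> range to_fract" by simp
  then show ?case using add unfolding h_def by simp
qed

text \<open>Up to associates, units are covered by the empty product.\<close>

lemma VFD_factorization:
  fixes x :: "'a::idom"
  assumes "VFD TYPE('a)" "x \<noteq> 0"
  obtains A where "\<forall>a\<in>#A. valuation_element a" "x dvd prod_mset A" "prod_mset A dvd x"
proof (cases "x dvd 1")
  case True
  then show ?thesis using that[of "{#}"] by simp
next
  case False
  then obtain as where "\<forall>a\<in>set as. valuation_element a" "x = prod_list as"
    using assms unfolding VFD_def by blast
  then show ?thesis using that[of "mset as"] by (simp add: prod_mset_prod_list)
qed

lemma VFD_integrally_closed:
  assumes "VFD TYPE('a::idom)" shows "integrally_closed_domain TYPE('a)"
  unfolding integrally_closed_domain_def
proof (intro allI impI)
  fix f :: "'a fract"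
  assume "\<exists>p :: 'a poly. lead_coeff p = 1 \<and> poly (fract_poly p) f = 0"
  then have f: "f \<in> V" if "valuation_overring V" for V
    using integral_in_valuation_overring[OF that] by blast
  obtain a b where ab: "f = to_fract a / to_fract b" and b: "b \<noteq> 0"
    by (rule fract_as_quotient)
  obtain A where A: "\<forall>a\<in>#A. valuation_element a" "b dvd prod_mset A"
    using VFD_factorization[OF assms b] by blast
  obtain c where "prod_mset A = b * c" using A(2) by (rule dvdE)
  then have "f * to_fract (prod_mset A) = to_fract (a * c)" using ab b by simp
  then show "f \<in> range to_fract" using cancel_denominator[OF f A(1)] by blast
qed

section \<open>Splitting divisors of products\<close>

text \<open>
  Testing divisibility of \<open>y * z\<close> by \<open>x\<close> in \<open>V\<close>: if \<open>y\<close> divides \<open>z\<close> in \<open>V\<close>, then \<open>x\<close> divides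
  \<open>z\<^sup>2\<close> there, and symmetrically. So the radical of \<open>x D\<close> is a prime ideal or all of \<open>D\<close>.
\<close>

lemma dvd_square_of_dvd_mult:
  assumes "tests_dvd V x" "x dvd y * z" shows "x dvd y\<^sup>2 \<or> x dvd z\<^sup>2"
proof -
  have V: "valuation_overring V" and O: "overring V"
    using assms(1) valuation_overring_overring unfolding tests_dvd_def by auto
  have x: "dvd_in V x (y * z)" by (rule dvd_in_of_dvd[OF O assms(2)])
  show ?thesis using dvd_in_linear[OF V, of y z]
  proof
    assume "dvd_in V y z"
    then have "dvd_in V (y * z) (z\<^sup>2)"
      using dvd_in_mult_left[of V y z z] by (simp add: power2_eq_square mult.commute)
    then show ?thesis using assms(1) dvd_in_trans[OF O x] unfolding tests_dvd_def by blast
  next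
    assume "dvd_in V z y"
    then have "dvd_in V (y * z) (y\<^sup>2)"
      using dvd_in_mult_left[of V z y y] by (simp add: power2_eq_square)
    then show ?thesis using assms(1) dvd_in_trans[OF O x] unfolding tests_dvd_def by blast
  qed
qed

lemma dvd_power_of_factor:
  assumes "tests_dvd V x" "x dvd prod_mset A ^ n"
  shows "x dvd 1 \<or> (\<exists>z\<in>#A. \<exists>m. x dvd z ^ m)"
  using assms(2)
proof (induction A arbitrary: n)
  case empty
  then show ?case by simp
next
  case (add z A)
  have "x dvd z ^ n * prod_mset A ^ n" using add.prems by (simp add: power_mult_distrib)
  then have "x dvd z ^ (n * 2) \<or> x dvd prod_mset A ^ (n * 2)"
    using dvd_square_of_dvd_mult[OF assms(1)] by (simp add: power_mult)
  then show ?case using add.IH by auto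
qed

lemma comparable_of_dvd_power:
  assumes "valuation_element z" "x dvd z ^ n" shows "x dvd z \<or> z dvd x"
proof -
  obtain W where "tests_dvd W z" using valuation_element_tests_dvd[OF assms(1)] .
  then show ?thesis
    using tests_dvd_linear tests_dvd_divisor[OF tests_dvd_power assms(2)] by blast
qed

lemma valuative_splits:
  assumes "tests_dvd V x" "\<forall>a\<in>#A. valuation_element a" "\<forall>b\<in>#B. valuation_element b"
    and "x dvd prod_mset A * prod_mset B"
  shows "\<exists>a b. x = a * b \<and> a dvd prod_mset A \<and> b dvd prod_mset B"
  using assms
proof (induction "size A + size B" arbitrary: A B x rule: less_induct)
  case less
  have "x dvd prod_mset (A + B) ^ 1" using less.prems(4) by simp
  from dvd_power_of_factor[OF less.prems(1) this]
  consider "x dvd 1" | z m where "z \<in># A + B" "x dvd z ^ m" by blast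
  then show ?case
  proof cases
    case 1
    then show ?thesis
      by (intro exI[of _ x] exI[of _ 1]) (simp add: dvd_trans[OF _ one_dvd])
  next
    case 2
    have zval: "valuation_element z" using 2(1) less.prems(2,3) by auto
    then have z0: "z \<noteq> 0" unfolding valuation_element_def by simp
    from comparable_of_dvd_power[OF zval 2(2)] show ?thesis
    proof
      assume xz: "x dvd z"
      from 2(1) have "x dvd prod_mset A \<or> x dvd prod_mset B"
        using dvd_trans[OF xz] dvd_prod_mset by auto
      then show ?thesis
        by (metis mult_1_left mult_1_right one_dvd)
    next
      assume "z dvd x"
      then obtain y where y: "x = z * y" by (rule dvdE)
      have ty: "tests_dvd V y" using tests_dvd_divisor[OF less.prems(1)] y by simp
      show ?thesis
      proof (cases "z \<in># A")
        case True
        then obtain A' where A': "A = add_mset z A'" by (rule mset_add)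
        have "y dvd prod_mset A' * prod_mset B"
          using less.prems(4) z0 unfolding y A' by (simp add: mult.assoc)
        then obtain a b where "y = a * b" "a dvd prod_mset A'" "b dvd prod_mset B"
          using less.hyps[of A' B y] less.prems ty A' by auto
        then show ?thesis unfolding y A'
          by (intro exI[of _ "z * a"] exI[of _ b]) (simp add: mult_ac)
      next
        case False
        then obtain B' where B': "B = add_mset z B'" using 2(1) by (auto dest: mset_add)
        have "z * y dvd z * (prod_mset A * prod_mset B')"
          using less.prems(4) unfolding y B' by (simp add: mult_ac)
        then have "y dvd prod_mset A * prod_mset B'" using z0 by simp
        then obtain a b where "y = a * b" "a dvd prod_mset A" "b dvd prod_mset B'"
          using less.hyps[of A B' y] less.prems ty B' by auto
        then show ?thesis unfolding y B'
          by (intro exI[of _ a] exI[of _ "z * b"]) (simp add: mult_ac)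
      qed
    qed
  qed
qed

text \<open>
  Products of valuation elements need not be valuation elements. Their factors are split off one
  at a time: the part of \<open>y * z\<close> left over after splitting \<open>x\<close> is again a product of a cofactor
  of \<open>y\<close> and one of \<open>z\<close>.
\<close>

lemma VFD_product_splits:
  fixes y z :: "'a::idom"
  assumes "VFD TYPE('a)"
    and "\<forall>a\<in>#A. valuation_element a" "y \<noteq> 0" "z \<noteq> 0" "prod_mset A dvd y * z"
  shows "\<exists>a b. prod_mset A = a * b \<and> a dvd y \<and> b dvd z"
  using assms(2-)
proof (induction A arbitrary: y z)
  case empty
  then show ?case by (intro exI[of _ 1]) simp
next
  case (add x A)
  obtain V where V: "tests_dvd V x"
    using add.prems(1) valuation_element_tests_dvd[of x] by auto
  then have x0: "x \<noteq> 0" unfolding tests_dvd_def by simp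
  obtain Y where Y: "\<forall>a\<in>#Y. valuation_element a" "y dvd prod_mset Y" "prod_mset Y dvd y"
    using VFD_factorization[OF assms(1) add.prems(2)] by blast
  obtain Z where Z: "\<forall>a\<in>#Z. valuation_element a" "z dvd prod_mset Z" "prod_mset Z dvd z"
    using VFD_factorization[OF assms(1) add.prems(3)] by blast
  have "x dvd y * z" using add.prems(4) dvd_mult_left[of x "prod_mset A"] by simp
  then have "x dvd prod_mset Y * prod_mset Z" using mult_dvd_mono[OF Y(2) Z(2)] dvd_trans by blast
  from valuative_splits[OF V Y(1) Z(1) this]
  obtain a b where ab: "x = a * b" "a dvd y" "b dvd z" using Y(3) Z(3) dvd_trans by blast
  then obtain y' z' where yz: "y = a * y'" "z = b * z'" by (auto elim!: dvdE)
  have "x * prod_mset A dvd x * (y' * z')"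
    using add.prems(4) unfolding yz ab(1) by (simp add: mult_ac)
  then have "prod_mset A dvd y' * z'" using x0 by simp
  then obtain c d where "prod_mset A = c * d" "c dvd y'" "d dvd z'"
    using add.IH[of y' z'] add.prems yz by auto
  then show ?case unfolding yz
    by (intro exI[of _ "a * c"] exI[of _ "b * d"]) (simp add: ab(1) mult_ac mult_dvd_mono)
qed

lemma VFD_pre_Schreier:
  assumes "VFD TYPE('a::idom)" shows "pre_Schreier_domain TYPE('a)"
  unfolding pre_Schreier_domain_def
proof (intro allI impI, elim conjE)
  fix x y z :: 'a
  assume nz: "x \<noteq> 0" "y \<noteq> 0" "z \<noteq> 0" and dvd: "x dvd y * z"
  show "\<exists>a b. x = a * b \<and> a dvd y \<and> b dvd z"
  proof (cases "x dvd 1")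
    case True
    then show ?thesis
      by (intro exI[of _ x] exI[of _ 1]) (simp add: dvd_trans[OF _ one_dvd])
  next
    case False
    then obtain as where "\<forall>a\<in>set as. valuation_element a" "x = prod_list as"
      using assms nz unfolding VFD_def by blast
    then show ?thesis
      using VFD_product_splits[OF assms, of "mset as" y z] nz dvd
      by (simp add: prod_mset_prod_list)
  qed
qed

theorem proposition2p1:
  assumes "VFD TYPE('a::idom)"
  shows "Schreier_domain TYPE('a)"
  using VFD_integrally_closed[OF assms] VFD_pre_Schreier[OF assms]
  unfolding Schreier_domain_def by blast

end
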